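(* Let $G$ be an infinite group of cardinality $\varkappa$. Then there exists a partition $G=\bigcup_{n\in\omega}A_n$ of $G$ into countably many cells such that $cov(A_nA_n^{-1})\ge cf(\varkappa)$ for each $n\in\omega$.
   Context: For a group $G$ and a (nonempty) subset $A\subseteq G$, $cov(A)=\min\{|X| : X\subseteq G,\ G=XA\}$, where $XA=\{xa : x\in X,\ a\in A\}$; also $AA^{-1}=\{ab^{-1} : a,b\in A\}$. For a cardinal $\varkappa$, $cf(\varkappa)$ denotes the cofinality of $\varkappa$. $\omega=\{0,1,2,\dots\}$. A partition $G=\bigcup_{n\in\omega}A_n$ means that the cells $A_n$ are nonempty, pairwise disjoint, and have union $G$. *)

theory Defs
  imports "HOL-Algebra.Coset" "HOL-Library.Disjoint_Sets"
begin

unbundle cardinal_syntax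

(* Cardinals are represented by cardinal orders, as in HOL.BNF_Cardinal_Order_Relation.
   A nonempty family of sets always has a member of least cardinality; the cardinal
   |X| does not depend (up to =o) on which one is chosen.  The value for the empty
   family is unspecified. *)
definition min_card :: "'a set set \<Rightarrow> 'a rel" where
  "min_card F = |SOME X. X \<in> F \<and> (\<forall>Y\<in>F. |X| \<le>o |Y| )|"

(* The library predicate "cofinal" is strict (every element has a strictly larger one
   in K).  An infinite cardinal order has no last element, so for infinite cardinals
   this is the usual unboundedness; for finite nonempty orders no such K exists. *)
definition cf :: "'a rel \<Rightarrow> 'a rel" where
  "cf r = min_card {K. K \<subseteq> Field r \<and> cofinal K r}"

definition cov :: "('a, 'b) monoid_scheme \<Rightarrow> 'a set \<Rightarrow> 'a rel" where
  "cov G A = min_card {X. X \<subseteq> carrier G \<and> carrier G = X <#>\<^bsub>G\<^esub> A}"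

lemma min_card_attained:
  assumes "F \<noteq> {}"
  shows "\<exists>X\<in>F. min_card F = |X| \<and> (\<forall>Y\<in>F. |X| \<le>o |Y| )"
proof -
  have "\<exists>r \<in> card_of ` F. \<forall>r' \<in> card_of ` F. r \<le>o r'"
    using assms by (intro exists_minim_Card_order) (auto simp: card_of_Card_order)
  then have "\<exists>X. X \<in> F \<and> (\<forall>Y\<in>F. |X| \<le>o |Y| )"
    by (simp add: Bex_def)
  from someI_ex[OF this] min_card_def[of F] show ?thesis
    by (elim conjE) (rule bexI, rule conjI)
qed

lemma cf_attained:
  assumes "Card_order r" "infinite (Field r)"
  shows "\<exists>K. K \<subseteq> Field r \<and> cofinal K r \<and> cf r = |K| \<and>
    (\<forall>L. L \<subseteq> Field r \<and> cofinal L r \<longrightarrow> |K| \<le>o |L| )"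
proof -
  have "Field r \<in> {K. K \<subseteq> Field r \<and> cofinal K r}"
    using infinite_Card_order_limit[OF assms] by (simp add: cofinal_def)
  then have "{K. K \<subseteq> Field r \<and> cofinal K r} \<noteq> {}"
    by (metis empty_iff)
  from min_card_attained[OF this] show ?thesis
    by (simp add: cf_def Bex_def)
qed

lemma cov_attained:
  assumes "group G" "A \<subseteq> carrier G" "A \<noteq> {}"
  shows "\<exists>X. X \<subseteq> carrier G \<and> carrier G = X <#>\<^bsub>G\<^esub> A \<and> cov G A = |X| \<and>
    (\<forall>Y. Y \<subseteq> carrier G \<and> carrier G = Y <#>\<^bsub>G\<^esub> A \<longrightarrow> |X| \<le>o |Y| )"
proof -
  interpret group G by fact
  obtain a where a: "a \<in> A" "a \<in> carrier G" using assms by auto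
  have "g \<in> carrier G <#>\<^bsub>G\<^esub> A" if "g \<in> carrier G" for g
  proof -
    have "g = (g \<otimes>\<^bsub>G\<^esub> inv\<^bsub>G\<^esub> a) \<otimes>\<^bsub>G\<^esub> a"
      using a that by (simp add: m_assoc)
    moreover have "g \<otimes>\<^bsub>G\<^esub> inv\<^bsub>G\<^esub> a \<in> carrier G"
      using a that by simp
    ultimately show ?thesis
      using a unfolding set_mult_def by blast
  qed
  moreover have "carrier G <#>\<^bsub>G\<^esub> A \<subseteq> carrier G"
    using assms(2) by (intro set_mult_closed) auto
  ultimately have "carrier G \<in> {X. X \<subseteq> carrier G \<and> carrier G = X <#>\<^bsub>G\<^esub> A}"
    by auto
  then have "{X. X \<subseteq> carrier G \<and> carrier G = X <#>\<^bsub>G\<^esub> A} \<noteq> {}"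
    by (metis empty_iff)
  from min_card_attained[OF this] show ?thesis
    unfolding cov_def Bex_def mem_Collect_eq Ball_def conj_assoc by metis
qed

end

theory Submission
  imports Defs "HOL-Algebra.Generated_Groups" "HOL-Library.Countable_Set"
begin

text \<open>
  Well-order the group \<open>G\<close> in the order type of its cardinal \<open>\<kappa>\<close>. For each \<open>a\<close> let \<open>L\<^sub>a\<close> and
  \<open>U\<^sub>a\<close> be the subgroups generated by the elements before \<open>a\<close>, and by those up to and including
  \<open>a\<close>. If \<open>a < a'\<close> then \<open>L\<^sub>a \<subseteq> U\<^sub>a \<subseteq> L\<^sub>a\<^sub>'\<close>. A set \<open>X\<close> of fewer than \<open>cf \<kappa>\<close> elements is not cofinal,
  so it lies in \<open>L\<^sub>a\<close> for all large \<open>a\<close>. Therefore it suffices that each cell \<open>A\<close> satisfies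
  \<open>L\<^sub>a A A\<inverse> \<noteq> G\<close> for arbitrarily large \<open>a\<close>.

  For \<open>b \<in> G\<close> the coset \<open>U\<^sub>a b\<close> contains \<open>L\<^sub>a b\<close>. Say that \<open>b\<close> \<^emph>\<open>drops\<close> at \<open>a\<close> if the least element of
  \<open>U\<^sub>a b\<close> is not in \<open>L\<^sub>a b\<close>. Two facts about drops carry the proof.

  \<^item> Every \<open>b\<close> has only finitely many drops (\<open>finite_drops\<close>). The coset \<open>U\<^sub>a b\<close> grows with \<open>a\<close>, so its
    least element can only decrease, and it decreases strictly at each drop. An infinite set of
    drops would contain an increasing sequence, along which the minima descend forever in a
    well-order.
  \<^item> If \<open>a \<notin> L\<^sub>a\<close> and no element of \<open>A\<close> drops at \<open>a\<close>, then \<open>a \<notin> L\<^sub>a A A\<inverse>\<close> (\<open>fresh_escapes\<close>). From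
    \<open>a = x u v\<inverse>\<close> with \<open>x \<in> L\<^sub>a\<close> follows \<open>U\<^sub>a u = U\<^sub>a v\<close>. The least element of this coset is in
    \<open>L\<^sub>a u\<close> and in \<open>L\<^sub>a v\<close>, whence \<open>u v\<inverse> \<in> L\<^sub>a\<close> and \<open>a \<in> L\<^sub>a\<close>.

  Call \<open>a\<close> \<^emph>\<open>fresh\<close> if \<open>a \<notin> L\<^sub>a\<close>. The fresh elements generate \<open>G\<close>, so for uncountable \<open>G\<close> there are
  \<open>\<kappa>\<close> of them, and they contain disjoint sets \<open>T\<^sub>0, T\<^sub>1, \<dots>\<close> of size \<open>\<kappa>\<close>, each of which is unbounded.
  The finitely many drops of \<open>b\<close> miss some \<open>T\<^sub>n\<close>; colour \<open>b\<close> with such an \<open>n\<close>. No element of colour \<open>n\<close>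
  drops at any \<open>a \<in> T\<^sub>n\<close>, so each colour class is as required. If \<open>G\<close> is countable, singletons
  serve as cells, because \<open>{u}{u}\<inverse> = {\<one>}\<close> needs all of \<open>G\<close> to cover \<open>G\<close>.
\<close>

section \<open>Countable colourings and partitions\<close>

text \<open>
  A colouring may leave some colours unused, whereas the cells of a partition indexed by
  \<open>\<nat>\<close> are nonempty. Since the desired property passes to nonempty subsets of colour classes,
  refining the colouring by a map of the infinite set \<open>S\<close> onto \<open>\<nat>\<close> makes exactly countably
  infinitely many classes occur, and these can be enumerated.
\<close>
lemma partition_from_countable_colouring:
  fixes c :: "'a \<Rightarrow> nat"
  assumes "infinite S"
    and good: "\<And>A n. A \<subseteq> {b \<in> S. c b = n} \<Longrightarrow> A \<noteq> {} \<Longrightarrow> P A"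
  shows "\<exists>A :: nat \<Rightarrow> 'a set. (\<forall>n. A n \<noteq> {}) \<and> disjoint_family A \<and> (\<Union>n. A n) = S \<and> (\<forall>n. P (A n))"
proof -
  obtain q :: "nat \<Rightarrow> 'a" where q: "inj q" "range q \<subseteq> S"
    using assms(1) by (auto simp: infinite_iff_countable_subset)
  define d where "d b = (c b, inv_into UNIV q b)" for b
  have "range (\<lambda>n. (n::nat)) \<subseteq> snd ` d ` S"
    using q by (force simp: d_def image_iff)
  then have "infinite (d ` S)"
    by (metis finite_imageI finite_subset image_ident infinite_UNIV_nat)
  then have e: "bij_betw (from_nat_into (d ` S)) UNIV (d ` S)"
    by (intro bij_betw_from_nat_into countableI_type)
  define A where "A n = {b \<in> S. d b = from_nat_into (d ` S) n}" for n
  have ne: "A n \<noteq> {}" for n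
  proof -
    have "from_nat_into (d ` S) n \<in> d ` S" using bij_betwE[OF e] by simp
    then show ?thesis by (auto simp: A_def)
  qed
  moreover have "disjoint_family A"
    using e by (auto simp: disjoint_family_on_def A_def bij_betw_def inj_on_def)
  moreover have "(\<Union>n. A n) = S"
    using e by (auto simp: A_def bij_betw_def image_iff)
  moreover have "P (A n)" for n
  proof (rule good[OF _ ne])
    have "c b = fst (d b)" for b by (simp add: d_def)
    then show "A n \<subseteq> {b \<in> S. c b = fst (from_nat_into (d ` S) n)}"
      by (auto simp: A_def)
  qed
  ultimately show ?thesis by blast
qed

section \<open>Finiteness of antitone families in a well-order\<close>

text \<open>
  Each nonempty subset of \<open>D\<close> has a greatest element, namely the one at which \<open>m\<close> is least. As
  \<open>D\<close> is also well-ordered, it is finite: by induction every proper initial segment is finite,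
  since it consists of its greatest element \<open>e\<close> and the segment below \<open>e\<close>.
\<close>
lemma finite_if_strictly_antitone:
  assumes wo: "Well_order r" and D: "D \<subseteq> Field r" and m: "m ` D \<subseteq> Field r"
    and anti: "\<And>a b. a \<in> D \<Longrightarrow> b \<in> D \<Longrightarrow> (a, b) \<in> r \<Longrightarrow> a \<noteq> b \<Longrightarrow> (m b, m a) \<in> r \<and> m b \<noteq> m a"
  shows "finite D"
proof -
  have wr: "wo_rel r" using wo by (simp add: wo_rel_def)
  have greatest: "\<exists>e\<in>E. \<forall>x\<in>E. x = e \<or> x \<in> underS r e" if E: "E \<subseteq> D" "E \<noteq> {}" for E
  proof -
    have "wo_rel.minim r (m ` E) \<in> m ` E" and "\<forall>x\<in>E. (wo_rel.minim r (m ` E), m x) \<in> r"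
      using E m by (auto intro!: wo_rel.minim_in[OF wr] wo_rel.minim_least[OF wr])
    then obtain e where e: "e \<in> E" "\<forall>x\<in>E. (m e, m x) \<in> r" by auto
    have "x = e \<or> x \<in> underS r e" if x: "x \<in> E" for x
    proof (rule ccontr)
      assume "\<not> ?thesis"
      then have "(e, x) \<in> r" "e \<noteq> x"
        using e(1) x E D wo_rel.in_notinI[OF wr, of x e] by (auto simp: underS_def)
      then have "(m x, m e) \<in> r" "m x \<noteq> m e"
        using anti e(1) x E by blast+
      then show False
        using e(2) x wo_rel.ANTISYM[OF wr] by (auto simp: antisym_def)
    qed
    with e(1) show ?thesis by blast
  qed
  have init: "finite (D \<inter> underS r a)" for a
  proof (induction a rule: wo_rel.well_order_induct[OF wr])
    case (1 a)
    show ?case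
    proof (cases "D \<inter> underS r a = {}")
      case False
      then obtain e where e: "e \<in> D \<inter> underS r a"
        "\<forall>x \<in> D \<inter> underS r a. x = e \<or> x \<in> underS r e"
        using greatest[of "D \<inter> underS r a"] by blast
      then have "finite (D \<inter> underS r e)"
        using 1 by (auto simp: underS_def)
      moreover have "D \<inter> underS r a \<subseteq> insert e (D \<inter> underS r e)"
        using e by blast
      ultimately show ?thesis by (meson finite_insert finite_subset)
    qed simp
  qed
  show ?thesis
  proof (cases "D = {}")
    case False
    then obtain e where "\<forall>x\<in>D. x = e \<or> x \<in> underS r e" using greatest[of D] by blast
    then have "D \<subseteq> insert e (D \<inter> underS r e)" by blast
    then show ?thesis using init[of e] by (meson finite_insert finite_subset)
  qed simp
qed

section \<open>The size of a generated subgroup\<close>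

lemma (in group) card_generate_le:
  assumes S: "S \<subseteq> carrier G" and inf: "infinite S"
  shows "|generate G S| \<le>o |S|"
proof -
  have inf': "infinite (Field |S| )" using inf by (simp add: Field_card_of)
  \<comment> \<open>Squaring \<open>E n\<close> instead of multiplying by generators keeps the union closed under products;
    it is an increasing sequence because \<open>\<one> \<in> E n\<close>.\<close>
  define E where "E = rec_nat (insert \<one> (S \<union> m_inv G ` S)) (\<lambda>_ B. (\<lambda>(x, y). x \<otimes> y) ` (B \<times> B))"
  have E0: "E 0 = insert \<one> (S \<union> m_inv G ` S)"
    and ES: "E (Suc n) = (\<lambda>(x, y). x \<otimes> y) ` (E n \<times> E n)" for n
    by (simp_all add: E_def)
  have carr: "E n \<subseteq> carrier G" for n
    by (induction n) (use S in \<open>auto simp: E0 ES\<close>)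
  have one: "\<one> \<in> E n" for n
    by (induction n) (force simp: E0 ES)+
  have "E n \<subseteq> E (Suc n)" for n
    using carr[of n] one[of n] by (force simp: ES image_iff)
  then have mono: "E m \<subseteq> E n" if "m \<le> n" for m n
    using that lift_Suc_mono_le[of E] by blast
  have "generate G S \<subseteq> (\<Union>n. E n)"
  proof
    fix x assume "x \<in> generate G S"
    then show "x \<in> (\<Union>n. E n)"
    proof (induction rule: generate.induct)
      case (eng x y)
      then obtain i j where "x \<in> E i" "y \<in> E j" by auto
      then have "x \<in> E (max i j)" "y \<in> E (max i j)"
        using mono[of i "max i j"] mono[of j "max i j"] by auto
      then have "x \<otimes> y \<in> E (Suc (max i j))" by (auto simp: ES)
      then show ?case by blast
    qed (use E0 in blast)+
  qed
  then have "|generate G S| \<le>o |\<Union>n. E n|" by (rule card_of_mono1)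
  moreover have "|E n| \<le>o |S|" for n
  proof (induction n)
    case 0
    have "|{\<one>}| \<le>o |S|" using inf by (intro card_of_singl_ordLeq) auto
    moreover have "|S \<union> m_inv G ` S| \<le>o |S|"
      by (rule card_of_Un_ordLeq_infinite_Field[OF inf' _ card_of_image card_of_Card_order])
        (rule card_of_mono1, simp)
    ultimately have "|{\<one>} \<union> (S \<union> m_inv G ` S)| \<le>o |S|"
      by (rule card_of_Un_ordLeq_infinite_Field[OF inf' _ _ card_of_Card_order])
    then show ?case by (simp add: E0)
  next
    case (Suc n)
    have "|E n \<times> E n| \<le>o |S|"
      by (rule card_of_Times_ordLeq_infinite_Field[OF inf' Suc Suc card_of_Card_order])
    then show ?case unfolding ES by (rule ordLeq_transitive[OF card_of_image])
  qed
  then have "|\<Union>n. E n| \<le>o |S|"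
    using inf by (intro card_of_UNION_ordLeq_infinite) (auto simp: infinite_iff_card_of_nat)
  ultimately show ?thesis by (rule ordLeq_transitive)
qed

section \<open>A chain of subgroups and the drops of an element\<close>

definition lower :: "('a, 'b) monoid_scheme \<Rightarrow> 'a \<Rightarrow> 'a set" where
  "lower G a = generate G (underS ( |carrier G| ) a)"

definition upper :: "('a, 'b) monoid_scheme \<Rightarrow> 'a \<Rightarrow> 'a set" where
  "upper G a = generate G (under ( |carrier G| ) a)"

definition first :: "('a, 'b) monoid_scheme \<Rightarrow> 'a set \<Rightarrow> 'a" where
  "first G S = wo_rel.minim ( |carrier G| ) S"

text \<open>
  If the element \<open>first G S\<close> is taken as representative of each coset \<open>S\<close>, then \<open>b\<close> drops at \<open>a\<close>
  exactly if its coset representative changes on passing from \<open>lower G a\<close> to \<open>upper G a\<close>.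
  The choice of least elements makes representatives at different levels comparable.
\<close>
definition drops :: "('a, 'b) monoid_scheme \<Rightarrow> 'a \<Rightarrow> 'a set" where
  "drops G b = {a \<in> carrier G. first G (upper G a #>\<^bsub>G\<^esub> b) \<notin> lower G a #>\<^bsub>G\<^esub> b}"

text \<open>
  These are the places where the chain grows: as \<open>a \<in> upper G a\<close>, freshness of \<open>a\<close> says that
  \<open>lower G a\<close> and \<open>upper G a\<close> differ.
\<close>
definition fresh :: "('a, 'b) monoid_scheme \<Rightarrow> 'a set" where
  "fresh G = {a \<in> carrier G. a \<notin> lower G a}"

lemma wo_rel_card_of: "wo_rel |A|"
  by (simp add: wo_rel_def card_of_Well_order)

lemma card_of_relD: "(x, y) \<in> |A| \<Longrightarrow> x \<in> A \<and> y \<in> A"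
  by (metis Field_card_of FieldI1 FieldI2)

lemma first_in: "S \<subseteq> carrier G \<Longrightarrow> S \<noteq> {} \<Longrightarrow> first G S \<in> S"
  unfolding first_def by (intro wo_rel.minim_in wo_rel_card_of) (auto simp: Field_card_of)

lemma first_least: "S \<subseteq> carrier G \<Longrightarrow> x \<in> S \<Longrightarrow> (first G S, x) \<in> |carrier G|"
  unfolding first_def by (intro wo_rel.minim_least wo_rel_card_of) (auto simp: Field_card_of)

context group
begin

lemma lower_subgroup: "subgroup (lower G a) G"
  unfolding lower_def by (rule generate_is_subgroup) (auto simp: underS_def dest: card_of_relD)

lemma upper_subgroup: "subgroup (upper G a) G"
  unfolding upper_def by (rule generate_is_subgroup) (auto simp: under_def dest: card_of_relD)

lemma lower_subset_upper: "lower G a \<subseteq> upper G a"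
  unfolding lower_def upper_def by (rule mono_generate) (auto simp: underS_def under_def)

lemma mem_upper: "a \<in> carrier G \<Longrightarrow> a \<in> upper G a"
  unfolding upper_def
  by (rule generate.incl)
    (metis Field_card_of wo_rel.REFL[OF wo_rel_card_of] Refl_under_in)

lemma upper_subset_lower:
  assumes "(a, b) \<in> |carrier G|" "a \<noteq> b"
  shows "upper G a \<subseteq> lower G b"
  unfolding lower_def upper_def
proof (rule mono_generate, rule subsetI)
  fix x assume "x \<in> under ( |carrier G| ) a"
  then have xa: "(x, a) \<in> |carrier G|" by (simp add: under_def)
  then have "(x, b) \<in> |carrier G|"
    using assms(1) wo_rel.TRANS[OF wo_rel_card_of] by (meson transD)
  moreover have "x \<noteq> b"
    using xa assms wo_rel.ANTISYM[OF wo_rel_card_of] by (meson antisymD)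
  ultimately show "x \<in> underS ( |carrier G| ) b" by (simp add: underS_def)
qed

text \<open>
  For drops \<open>x < y\<close>, the least element of \<open>upper G x #> b\<close> already lies in \<open>lower G y #> b\<close>, and by
  definition of a drop the least element of \<open>upper G y #> b\<close> does not; so it is strictly smaller.
\<close>
lemma finite_drops:
  assumes b: "b \<in> carrier G"
  shows "finite (drops G b)"
proof (rule finite_if_strictly_antitone[OF card_of_Well_order])
  let ?m = "\<lambda>a. first G (upper G a #> b)"
  have sub: "upper G a #> b \<subseteq> carrier G" for a
    using b by (intro r_coset_subset_G subgroup.subset upper_subgroup)
  have mem: "?m a \<in> upper G a #> b" for a
    using b sub rcos_self[OF b upper_subgroup] by (intro first_in) auto
  show "drops G b \<subseteq> Field |carrier G|"
    by (auto simp: drops_def Field_card_of)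
  show "?m ` drops G b \<subseteq> Field |carrier G|"
    using sub mem by (auto simp: Field_card_of)
  fix x y assume xy: "x \<in> drops G b" "y \<in> drops G b" "(x, y) \<in> |carrier G|" "x \<noteq> y"
  have in_lower: "?m x \<in> lower G y #> b"
    using mem[of x] upper_subset_lower[OF xy(3,4)] by (auto simp: r_coset_def)
  then have "?m x \<in> upper G y #> b"
    using lower_subset_upper[of y] by (auto simp: r_coset_def)
  then have "(?m y, ?m x) \<in> |carrier G|"
    by (rule first_least[OF sub])
  moreover have "?m y \<noteq> ?m x"
    using in_lower xy(2) by (auto simp: drops_def)
  ultimately show "(?m y, ?m x) \<in> |carrier G| \<and> ?m y \<noteq> ?m x" ..
qed

text \<open>A finite set cannot meet all members of an infinite disjoint family.\<close>
lemma drops_avoid_some_member: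
  assumes T: "disjoint_family (T :: nat \<Rightarrow> 'a set)" and b: "b \<in> carrier G"
  shows "\<exists>n. drops G b \<inter> T n = {}"
proof (rule ccontr)
  assume "\<not> ?thesis"
  then have "\<forall>n. \<exists>x. x \<in> drops G b \<inter> T n" by blast
  from choice[OF this] obtain t where t: "\<And>n. t n \<in> drops G b \<inter> T n" by blast
  have "inj t"
  proof (rule injI, rule ccontr)
    fix i j assume "t i = t j" "i \<noteq> j"
    then have "t i \<in> T i \<inter> T j" using t[of i] t[of j] by auto
    with \<open>i \<noteq> j\<close> T show False by (auto simp: disjoint_family_on_def)
  qed
  moreover have "range t \<subseteq> drops G b" using t by blast
  ultimately show False
    using finite_drops[OF b] by (meson finite_imageD finite_subset infinite_UNIV_nat)
qed

text \<open>
  Membership of \<open>u\<close> and \<open>v\<close> in the same coset of \<open>upper G a\<close> forces, in the absence of drops, membership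
  in the same coset of the smaller group \<open>lower G a\<close>, because both of these contain the same
  least element.
\<close>
lemma fresh_escapes:
  assumes a: "a \<in> fresh G" and X: "X \<subseteq> lower G a"
    and A: "A \<subseteq> carrier G" "\<And>b. b \<in> A \<Longrightarrow> a \<notin> drops G b"
  shows "a \<notin> X <#> (A <#> set_inv A)"
proof
  assume "a \<in> X <#> (A <#> set_inv A)"
  then obtain x u v where xuv: "x \<in> X" "u \<in> A" "v \<in> A" "a = x \<otimes> (u \<otimes> inv v)"
    by (auto simp: set_mult_def SET_INV_def)
  interpret H: subgroup "lower G a" G by (rule lower_subgroup)
  have aG: "a \<in> carrier G" and fr: "a \<notin> lower G a" using a by (auto simp: fresh_def)
  have xH: "x \<in> lower G a" and uG: "u \<in> carrier G" and vG: "v \<in> carrier G"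
    using xuv X A by auto
  then have xG: "x \<in> carrier G" by simp
  \<comment> \<open>As \<open>a\<close> and \<open>x\<close> are in \<open>upper G a\<close>, this puts \<open>u\<close> and \<open>v\<close> into one coset of it.\<close>
  have av: "a \<otimes> v = x \<otimes> u"
    using xuv(4) xG uG vG by (simp add: m_assoc)
  have absorb: "upper G a #> (k \<otimes> w) = upper G a #> w"
    if "k \<in> upper G a" "w \<in> carrier G" for k w
    using that subgroup.mem_carrier[OF upper_subgroup, of k a]
    by (metis coset_mult_assoc coset_join2 subgroup.subset upper_subgroup)
  have "upper G a #> v = upper G a #> u"
    using absorb[of a v] absorb[of x u] av aG uG vG xH mem_upper lower_subset_upper by auto
  then obtain t where "t \<in> lower G a #> u" "t \<in> lower G a #> v"
    using A(2)[OF xuv(2)] A(2)[OF xuv(3)] aG by (auto simp: drops_def)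
  then obtain h k where hk: "h \<in> lower G a" "k \<in> lower G a" "h \<otimes> u = k \<otimes> v"
    by (auto simp: r_coset_def)
  then have "h \<otimes> u \<otimes> inv v = k"
    using vG by (simp add: m_assoc)
  then have "u \<otimes> inv v = inv h \<otimes> k"
    using hk uG vG by (metis H.mem_carrier inv_solve_left inv_closed m_assoc m_closed)
  then have "x \<otimes> (u \<otimes> inv v) \<in> lower G a"
    using xH hk(1,2) by simp
  then show False using fr by (simp only: xuv(4)[symmetric] not_True_eq_False)
qed

section \<open>The number of fresh elements\<close>

text \<open>An element that is not fresh is generated by earlier ones, so induction along the well-order applies.\<close>
lemma carrier_generated_by_fresh: "carrier G = generate G (fresh G)"
proof
  have sub: "fresh G \<subseteq> carrier G" by (auto simp: fresh_def)
  then show "generate G (fresh G) \<subseteq> carrier G" by (rule generate_incl)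
  have "a \<in> carrier G \<longrightarrow> a \<in> generate G (fresh G)" for a
  proof (induction a rule: wo_rel.well_order_induct[OF wo_rel_card_of[of "carrier G"]])
    case (1 a)
    show ?case
    proof (intro impI, cases "a \<in> fresh G")
      case False
      assume "a \<in> carrier G"
      then have "a \<in> lower G a" using False by (simp add: fresh_def)
      moreover have "underS ( |carrier G| ) a \<subseteq> generate G (fresh G)"
        using 1 by (auto simp: underS_def dest: card_of_relD)
      then have "lower G a \<subseteq> generate G (fresh G)"
        unfolding lower_def by (rule generate_subgroup_incl[OF _ generate_is_subgroup[OF sub]])
      ultimately show "a \<in> generate G (fresh G)" by blast
    qed (rule generate.incl)
  qed
  then show "carrier G \<subseteq> generate G (fresh G)" by blast
qed

lemma card_fresh:
  assumes unc: "uncountable (carrier G)"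
  shows "infinite (fresh G)" "|carrier G| \<le>o |fresh G|"
proof -
  have sub: "fresh G \<subseteq> carrier G" by (auto simp: fresh_def)
  show inf: "infinite (fresh G)"
  proof
    assume fin: "finite (fresh G)"
    \<comment> \<open>The bound on generated subgroups is for infinite sets; a countable padding provides one.\<close>
    have "infinite (carrier G)" using unc countable_finite by blast
    then obtain q :: "nat \<Rightarrow> 'a" where q: "inj q" "range q \<subseteq> carrier G"
      by (auto simp: infinite_iff_countable_subset)
    let ?S = "fresh G \<union> range q"
    have "infinite ?S" using q(1) by (simp add: finite_image_iff)
    then have "|generate G ?S| \<le>o |?S|" using sub q by (intro card_generate_le) auto
    moreover have "|carrier G| \<le>o |generate G ?S|"
      using mono_generate[of "fresh G" ?S] carrier_generated_by_fresh by (intro card_of_mono1) auto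
    ultimately have "|carrier G| \<le>o |?S|" using ordLeq_transitive by blast
    then obtain f where "inj_on f (carrier G)" "f ` carrier G \<subseteq> ?S"
      by (auto simp: card_of_ordLeq[symmetric])
    moreover have "countable ?S" using fin by (simp add: countable_finite)
    ultimately have "countable (carrier G)"
      by (meson countable_image_inj_on countable_subset)
    with unc show False ..
  qed
  then show "|carrier G| \<le>o |fresh G|"
    using card_generate_le[OF sub] carrier_generated_by_fresh by simp
qed

lemma split_fresh:
  assumes unc: "uncountable (carrier G)"
  shows "\<exists>T :: nat \<Rightarrow> 'a set. disjoint_family T \<and> (\<forall>n. T n \<subseteq> fresh G) \<and> (\<forall>n. |carrier G| \<le>o |T n| )"
proof -
  note fresh = card_fresh[OF unc]
  have "|fresh G \<times> (UNIV :: nat set)| =o |fresh G|"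
    using fresh(1) by (intro card_of_Times_infinite_simps) (auto simp: infinite_iff_card_of_nat)
  then obtain p where p: "inj_on p (fresh G \<times> (UNIV :: nat set))" "p ` (fresh G \<times> UNIV) \<subseteq> fresh G"
    using ordIso_imp_ordLeq card_of_ordLeq[of "fresh G \<times> (UNIV :: nat set)" "fresh G"] by blast
  define T where "T n = p ` (fresh G \<times> {n})" for n
  have "disjoint_family T"
    using p(1) by (auto simp: disjoint_family_on_def T_def inj_on_def)
  moreover have "T n \<subseteq> fresh G" for n
    using p(2) by (auto simp: T_def)
  moreover have "|carrier G| \<le>o |T n|" for n
  proof -
    have "inj_on (\<lambda>a. p (a, n)) (fresh G)" "(\<lambda>a. p (a, n)) ` fresh G \<subseteq> T n"
      using p(1) by (auto simp: T_def inj_on_def)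
    then have "|fresh G| \<le>o |T n|" using card_of_ordLeq by blast
    with fresh(2) show ?thesis by (rule ordLeq_transitive)
  qed
  ultimately show ?thesis by blast
qed

section \<open>Cofinality of covering sets\<close>

text \<open>
  A bound \<open>c\<close> of \<open>X\<close> lies strictly below some \<open>d\<close>, as infinite cardinals have no last element, and
  fewer than \<open>|G|\<close> elements lie below \<open>d\<close>; hence \<open>T\<close> has an element that is at least \<open>d\<close>.
\<close>
lemma large_set_bounds_noncofinal:
  assumes inf: "infinite (carrier G)" and T: "T \<subseteq> carrier G" "|carrier G| \<le>o |T|"
    and X: "X \<subseteq> carrier G" "\<not> cofinal X |carrier G|"
  shows "\<exists>a\<in>T. X \<subseteq> lower G a"
proof -
  let ?r = "|carrier G|"
  note wr = wo_rel_card_of[of "carrier G"]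
  obtain c where c: "c \<in> carrier G" "\<forall>x\<in>X. c = x \<or> (c, x) \<notin> ?r"
    using X(2) by (auto simp: cofinal_def Field_card_of)
  obtain d where d: "d \<in> carrier G" "c \<noteq> d" "(c, d) \<in> ?r"
    using infinite_Card_order_limit[OF card_of_Card_order, of "carrier G" c] inf c(1)
    by (auto simp: Field_card_of)
  have "\<not> T \<subseteq> underS ?r d"
  proof
    assume "T \<subseteq> underS ?r d"
    then have "|T| \<le>o |underS ?r d|" by (rule card_of_mono1)
    moreover have "|underS ?r d| <o ?r"
      using d(1) by (intro card_of_underS card_of_Card_order) (simp add: Field_card_of)
    ultimately show False
      using T(2) by (meson not_ordLess_ordLeq ordLeq_transitive)
  qed
  then obtain a where a: "a \<in> T" "a \<notin> underS ?r d" by blast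
  have da: "(d, a) \<in> ?r"
    using a T(1) d(1) wo_rel.in_notinI[OF wr, of a d] wo_rel.REFL[OF wr]
    by (auto simp: underS_def Field_card_of refl_on_def)
  have "x \<in> lower G a" if x: "x \<in> X" for x
  proof -
    have "(x, c) \<in> ?r"
      using x X(1) c wo_rel.in_notinI[OF wr, of c x] wo_rel.REFL[OF wr]
      by (auto simp: Field_card_of refl_on_def)
    then have "upper G x \<subseteq> upper G c"
      using upper_subset_lower[of x c] lower_subset_upper[of c] by (cases "x = c") auto
    moreover have "upper G c \<subseteq> lower G d" using d by (intro upper_subset_lower)
    moreover have "lower G d \<subseteq> lower G a"
      using da upper_subset_lower[of d a] lower_subset_upper[of d] by (cases "d = a") auto
    ultimately show ?thesis using mem_upper[of x] x X(1) by blast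
  qed
  with a(1) show ?thesis by blast
qed

text \<open>
  This replaces the comparison of cardinals by an order-theoretic condition on the
  covering sets: a cofinal set has at least \<open>cf |G|\<close> elements.
\<close>
lemma cf_le_cov:
  assumes inf: "infinite (carrier G)" and A: "A \<subseteq> carrier G" "A \<noteq> {}"
    and covers: "\<And>X. X \<subseteq> carrier G \<Longrightarrow> carrier G = X <#> (A <#> set_inv A) \<Longrightarrow> cofinal X |carrier G|"
  shows "cf |carrier G| \<le>o cov G (A <#> set_inv A)"
proof -
  have "A <#> set_inv A \<subseteq> carrier G" "A <#> set_inv A \<noteq> {}"
    using A by (auto simp: set_mult_def SET_INV_def)
  from cov_attained[OF is_group this] obtain X
    where X: "X \<subseteq> carrier G" "carrier G = X <#> (A <#> set_inv A)" "cov G (A <#> set_inv A) = |X|"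
    by blast
  then have "cofinal X |carrier G|" by (intro covers)
  then have "cf |carrier G| \<le>o |X|"
    using cf_attained[OF card_of_Card_order, of "carrier G"] inf X(1)
    by (auto simp: Field_card_of)
  with X(3) show ?thesis by simp
qed

lemma cofinal_if_covers_singleton:
  assumes "infinite (carrier G)" "u \<in> carrier G" "X \<subseteq> carrier G"
    and "carrier G = X <#> ({u} <#> set_inv {u})"
  shows "cofinal X |carrier G|"
proof -
  have "X <#> ({u} <#> set_inv {u}) = X"
    using assms(2,3) by (force simp: set_mult_def SET_INV_def)
  with assms(4) have "X = carrier G" by simp
  then show ?thesis
    using infinite_Card_order_limit[OF card_of_Card_order, of "carrier G"] assms(1)
    by (auto simp: cofinal_def Field_card_of)
qed

end

section \<open>The partition\<close>

theorem theorem1: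
  fixes G :: "('a, 'b) monoid_scheme"
  assumes "group G" and "infinite (carrier G)"
  shows "\<exists>A :: nat \<Rightarrow> 'a set.
    (\<forall>n. A n \<noteq> {}) \<and> disjoint_family A \<and> (\<Union>n. A n) = carrier G \<and>
    (\<forall>n. cf |carrier G| \<le>o cov G (A n <#>\<^bsub>G\<^esub> set_inv\<^bsub>G\<^esub> (A n)))"
proof -
  interpret group G by fact
  have "\<exists>c :: 'a \<Rightarrow> nat. \<forall>n A. A \<subseteq> {b \<in> carrier G. c b = n} \<longrightarrow> A \<noteq> {} \<longrightarrow>
      cf |carrier G| \<le>o cov G (A <#>\<^bsub>G\<^esub> set_inv\<^bsub>G\<^esub> A)"
  proof (cases "countable (carrier G)")
    case True
    then obtain c :: "'a \<Rightarrow> nat" where c: "inj_on c (carrier G)"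
      by (auto simp: countable_def)
    have "cf |carrier G| \<le>o cov G (A <#>\<^bsub>G\<^esub> set_inv\<^bsub>G\<^esub> A)"
      if A: "A \<subseteq> {b \<in> carrier G. c b = n}" "A \<noteq> {}" for A n
    proof -
      obtain u where "u \<in> A" using A(2) by blast
      then have u: "A = {u}" "u \<in> carrier G"
        using A(1) c unfolding inj_on_def by blast+
      show ?thesis
        unfolding u(1)
        by (rule cf_le_cov[OF assms(2)]) (use u(2) cofinal_if_covers_singleton[OF assms(2)] in auto)
    qed
    then show ?thesis by blast
  next
    case False
    from split_fresh[OF this] obtain T :: "nat \<Rightarrow> 'a set"
      where T: "disjoint_family T" "\<And>n. T n \<subseteq> fresh G" "\<And>n. |carrier G| \<le>o |T n|"
      by blast
    obtain c :: "'a \<Rightarrow> nat" where c: "\<And>b. b \<in> carrier G \<Longrightarrow> drops G b \<inter> T (c b) = {}"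
      using drops_avoid_some_member[OF T(1)] by metis
    have "cf |carrier G| \<le>o cov G (A <#>\<^bsub>G\<^esub> set_inv\<^bsub>G\<^esub> A)"
      if A: "A \<subseteq> {b \<in> carrier G. c b = n}" "A \<noteq> {}" for A n
    proof (rule cf_le_cov[OF assms(2)])
      show AG: "A \<subseteq> carrier G" "A \<noteq> {}" using A by auto
      fix X assume X: "X \<subseteq> carrier G" "carrier G = X <#>\<^bsub>G\<^esub> (A <#>\<^bsub>G\<^esub> set_inv\<^bsub>G\<^esub> A)"
      show "cofinal X |carrier G|"
      proof (rule ccontr)
        assume nc: "\<not> cofinal X |carrier G|"
        have TG: "T n \<subseteq> carrier G" using T(2)[of n] by (auto simp: fresh_def)
        obtain a where a: "a \<in> T n" "X \<subseteq> lower G a"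
          using large_set_bounds_noncofinal[OF assms(2) TG T(3) X(1) nc] by blast
        have "a \<notin> drops G b" if "b \<in> A" for b
          using c[of b] a(1) A(1) that by auto
        then have "a \<notin> X <#>\<^bsub>G\<^esub> (A <#>\<^bsub>G\<^esub> set_inv\<^bsub>G\<^esub> A)"
          using fresh_escapes[of a X A] a T(2) AG(1) by blast
        with X(2) a(1) TG show False by auto
      qed
    qed
    then show ?thesis by blast
  qed
  then obtain c :: "'a \<Rightarrow> nat" where c: "\<And>n A. A \<subseteq> {b \<in> carrier G. c b = n} \<Longrightarrow> A \<noteq> {} \<Longrightarrow>
      cf |carrier G| \<le>o cov G (A <#>\<^bsub>G\<^esub> set_inv\<^bsub>G\<^esub> A)"
    by blast
  show ?thesis
    by (rule partition_from_countable_colouring[OF assms(2) c])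
qed

end
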